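(* Let $m>1$ be an odd integer. Then $I_r(\mathbb{Z}/2m\mathbb{Z})=I_r(\mathbb{Z}/m\mathbb{Z})$.
   Context: For a finite commutative ring $R$, $I_r(R)$ (the Erdős–Burgess constant of the multiplicative semigroup of $R$) is the smallest positive integer $t$ such that every sequence of $t$ (not necessarily distinct) elements of $R$ contains a nonempty subsequence whose elements multiply to an idempotent element of $R$ (an element $x$ with $x^2=x$). *)

theory Defs
  imports "HOL-Number_Theory.Residues"
begin

definition ring_idempotent :: "('a, 'b) ring_scheme \<Rightarrow> 'a \<Rightarrow> bool" where
  "ring_idempotent R x \<longleftrightarrow> x \<in> carrier R \<and> x \<otimes>\<^bsub>R\<^esub> x = x"

text \<open>
  A nonempty subsequence of a sequence \<open>xs\<close> is given by a nonempty set of positions of \<open>xs\<close>,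
  so that repeated elements count with their multiplicity.
\<close>
definition has_idempotent_product_subseq :: "('a, 'b) ring_scheme \<Rightarrow> 'a list \<Rightarrow> bool" where
  "has_idempotent_product_subseq R xs \<longleftrightarrow>
     (\<exists>I. I \<noteq> {} \<and> I \<subseteq> {..<length xs} \<and>
        ring_idempotent R (\<Otimes>\<^bsub>R\<^esub>i\<in>I. xs ! i))"

text \<open>
  For a finite commutative ring the set of admissible \<open>t\<close> is nonempty, because every element
  has an idempotent power; for other rings the value may be unspecified.
\<close>
definition erdos_burgess :: "('a, 'b) ring_scheme \<Rightarrow> nat" where
  "erdos_burgess R =
     (LEAST t. 0 < t \<and>
        (\<forall>xs. length xs = t \<and> set xs \<subseteq> carrier R \<longrightarrow> has_idempotent_product_subseq R xs))"

end

theory Submission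
  imports Defs
begin

text \<open>
  Since P * (P - 1) is always even, it is divisible by 2 * m iff it is divisible by the odd number m.
  So an integer is idempotent modulo 2 * m iff it is idempotent modulo m, and reducing a sequence
  modulo m does not change which of its subsequences have an idempotent product.
\<close>

text \<open>The difference \<open>a * a - a\<close> is kept factored as a product of consecutive
  integers, whose evenness later allows the modulus to be doubled.\<close>

lemma (in residues) ring_idempotent_mod_iff:
  "ring_idempotent R (a mod m) \<longleftrightarrow> m dvd a * (a - 1)"
proof -
  have "ring_idempotent R (a mod m) \<longleftrightarrow> (a * a) mod m = a mod m"
    by (simp add: ring_idempotent_def mult_cong)
  also have "\<dots> \<longleftrightarrow> m dvd a * (a - 1)"
    by (simp add: mod_eq_dvd_iff algebra_simps)
  finally show ?thesis .
qed

lemma (in residues) has_idempotent_product_subseq_map_mod: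
  "has_idempotent_product_subseq R (map (\<lambda>x. x mod m) xs) \<longleftrightarrow>
     (\<exists>I. I \<noteq> {} \<and> I \<subseteq> {..<length xs} \<and> m dvd (\<Prod>i\<in>I. xs ! i) * ((\<Prod>i\<in>I. xs ! i) - 1))"
proof -
  \<comment> \<open>The bound on \<open>I\<close> serves twice: it allows \<open>map\<close> to be
    evaluated at each position, and it makes \<open>I\<close> finite for
    \<open>prod_cong\<close>.\<close>
  have "(\<Otimes>i\<in>I. map (\<lambda>x. x mod m) xs ! i) = (\<Prod>i\<in>I. xs ! i) mod m"
    if I: "I \<subseteq> {..<length xs}" for I
  proof -
    have "(\<Otimes>i\<in>I. map (\<lambda>x. x mod m) xs ! i) = (\<Otimes>i\<in>I. (xs ! i) mod m)"
      by (rule finprod_cong') (use I in auto)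
    also have "\<dots> = (\<Prod>i\<in>I. xs ! i) mod m"
      using I finite_subset by (intro prod_cong) blast
    finally show ?thesis .
  qed
  then show ?thesis
    unfolding has_idempotent_product_subseq_def
    by (auto simp: ring_idempotent_mod_iff cong: conj_cong)
qed

text \<open>Lists over the carrier are exactly the reductions of integer lists, each being its own
  reduction. Quantifying over all integer lists leaves the modulus only in the divisibility, so
  different rings can be compared.\<close>

lemma (in residues) erdos_burgess_eq:
  "erdos_burgess R =
     (LEAST t. 0 < t \<and> (\<forall>xs. length xs = t \<longrightarrow>
        (\<exists>I. I \<noteq> {} \<and> I \<subseteq> {..<t} \<and> m dvd (\<Prod>i\<in>I. xs ! i) * ((\<Prod>i\<in>I. xs ! i) - 1))))"
proof -
  have "xs = map (\<lambda>x. x mod m) xs" if "set xs \<subseteq> carrier R" for xs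
    using that by (intro map_idI[symmetric]) (auto simp: res_carrier_eq)
  moreover have "set (map (\<lambda>x. x mod m) xs) \<subseteq> carrier R" for xs
    by auto
  ultimately have "(\<forall>xs. length xs = t \<and> set xs \<subseteq> carrier R \<longrightarrow> has_idempotent_product_subseq R xs) \<longleftrightarrow>
        (\<forall>xs. length xs = t \<longrightarrow> has_idempotent_product_subseq R (map (\<lambda>x. x mod m) xs))" for t
    by (metis length_map)
  then show ?thesis
    unfolding erdos_burgess_def has_idempotent_product_subseq_map_mod
    by (simp cong: conj_cong imp_cong)
qed

theorem theorem1p6:
  fixes m :: int
  assumes "m > 1" and "odd m"
  shows "erdos_burgess (residue_ring (2 * m)) = erdos_burgess (residue_ring m)"
proof -
  have "2 * m dvd P * (P - 1) \<longleftrightarrow> m dvd P * (P - 1)" for P :: int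
  proof
    assume "m dvd P * (P - 1)"
    moreover have "2 dvd P * (P - 1)" by simp
    moreover have "coprime 2 m" using assms(2) by simp
    ultimately show "2 * m dvd P * (P - 1)" by (metis divides_mult)
  qed (rule dvd_mult_right)
  moreover have "residues m" and "residues (2 * m)"
    using assms(1) by (auto simp: residues_def)
  \<comment> \<open>Both constants are now least elements of sets whose conditions differ only in
    the divisor, \<open>2 * m\<close> or \<open>m\<close>.\<close>
  ultimately show ?thesis
    by (simp add: residues.erdos_burgess_eq)
qed

end
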